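(* Let $\xi:I\to\mathbb Z$ be a height function, $1\le i\le j\le n$, let $\mathcal G$ be the snake graph associated to the Hernandez-Leclerc module parameterized by $\alpha_{i,j}$, and let $F=\sum_{P\in\mathrm{Match}(\mathcal G)}y(P)$ be its $F$-polynomial. Then $$F|_{\mathbb P}=y(P_+)|_{\mathbb P}=(y_iy_{i+1}\cdots y_j)|_{\mathbb P},$$ where $F|_{\mathbb P}=\bigoplus_{P\in\mathrm{Match}(\mathcal G)}y(P)$ and, for a Laurent monomial $m\in\mathbb P$, $m|_{\mathbb P}:=1\oplus m$.
   Context: **Height functions and quivers.** $I=\{1,\dots,n\}$. A height function is $\xi:I\to\mathbb Z$ with $|\xi(i)-\xi(i+1)|=1$ for $1\le i\le n-1$, extended by $\xi(0)=\xi(2)$, $\xi(n+1)=\xi(n-1)$. For $i<n$, $i_\diamond=\min\{\ell\in[i,n]:\xi(\ell)=\xi(\ell+2)\}$, and $n_\diamond=n$. A vertex $i\in I$ is called a source or sink if $i=n$ or $\xi(i)=\xi(i+2)$ (frozen vertices are ignored). The quiver $Q_\xi$ has mutable vertices $I$ and frozen vertices $1',\dots,n'$. For each $i\in I$ with $\xi(i)=\xi(i+1)+1$ it has arrows $i\to i-1$, $i'\to i$, and: if $i=i_\diamond$, $i\to i+1$; if $i\ne i_\diamond$, $i+1\to i$ and $i\to(i+1)'$. If $\xi(i)=\xi(i+1)-1$, all these arrows are reversed. Arrows involving $0$ or $n+1$ are omitted, and an arrow described twice is taken once. The variable at vertex $i$ is $x_i$ and at $i'$ is $x_i'$. **Coefficients.**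 For fixed $i\le j$, $\mathbb P$ is the tropical semifield freely generated (as multiplicative abelian group) by $x_1',\dots,x_n'$ and the $x_\ell$, $\ell\in I\setminus[i,j]$, with $\prod u^{a_u}\oplus\prod u^{b_u}=\prod u^{\min(a_u,b_u)}$. For $i\le\ell\le j$, $y_\ell=\prod_{u\to\ell}u\prod_{\ell\to u}u^{-1}\in\mathbb P$, the products over arrows of $Q_\xi$ between $\ell$ and vertices whose variable $u$ is one of these generators. **Snake graph.** A tile is a unit square with sides parallel to the axes. The snake graph $\mathcal G=(G_i,\dots,G_j)$ associated to (the Hernandez-Leclerc module parameterized by) $\alpha_{i,j}=\alpha_i+\cdots+\alpha_j$ is built from the full subquiver $Q$ of $Q_\xi$ on $\{i,\dots,j\}$: $G_{i+1}$ is glued to the east edge of $G_i$; for $i+2\le\ell\le j$, $G_\ell$ is glued to the north or east edge of $G_{\ell-1}$ so that $G_{\ell-2},G_{\ell-1},G_\ell$ lie in one row or column if $\ell-1$ is a source or sink, and do not otherwise. There are exactly two perfect matchings of $\mathcal G$ with only boundary edges, $P_-$ and $P_+$: if $Q$ has an arrow $i+1\to i$, $P_-$ is the one containing the west edge of $G_i$; otherwise (including $i=j$) $P_-$ is the one containing the south edge of $G_i$; $P_+$ is the other. $\mathrm{Match}(\mathcal G)$ is the set of perfect matchings. For $P\in\mathrm{Match}(\mathcal G)$, $P\ominus P_-$ is the boundary of a union of tiles $G_\ell$, $\ell\in J$, and $y(P)=\prod_{\ell\in J}y_\ell$. *)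

theory Defs
  imports Complex_Main "HOL-Library.Poly_Mapping"
begin

section \<open>Tropical semifields\<close>

text \<open>
  The tropical semifield freely generated by a set of variables: \<open>Monomial a\<close> is the Laurent
  monomial \<open>\<Prod>u. u ^ a u\<close>, with finitely supported exponent vector \<open>a\<close>.  The group is written
  multiplicatively.  Tropical addition takes the minimum of the exponents; it is the meet of
  the exponentwise order, so the finite tropical sum of a nonempty family is \<open>Inf_fin\<close>
  of its set of values (\<open>\<oplus>\<close> is idempotent, so repeated values do not matter).
\<close>

datatype 'u trop = Monomial (exponents: "'u \<Rightarrow>\<^sub>0 int")

definition expo :: "'u trop \<Rightarrow> 'u \<Rightarrow> int" where
  "expo m u = Poly_Mapping.lookup (exponents m) u"

lemma trop_eqI: "(\<And>u. expo a u = expo b u) \<Longrightarrow> a = b"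
  by (cases a; cases b) (auto simp: expo_def intro: poly_mapping_eqI)

instantiation trop :: (type) "{comm_monoid_mult, inverse}"
begin

definition one_trop :: "'a trop" where
  "1 = Monomial 0"

definition times_trop :: "'a trop \<Rightarrow> 'a trop \<Rightarrow> 'a trop" where
  "a * b = Monomial (exponents a + exponents b)"

definition inverse_trop :: "'a trop \<Rightarrow> 'a trop" where
  "inverse a = Monomial (- exponents a)"

definition divide_trop :: "'a trop \<Rightarrow> 'a trop \<Rightarrow> 'a trop" where
  "(a :: 'a trop) div b = a * inverse b"

instance
  by standard (simp_all add: one_trop_def times_trop_def add.assoc add.commute)

end

lift_definition min_exponents :: "('u \<Rightarrow>\<^sub>0 int) \<Rightarrow> ('u \<Rightarrow>\<^sub>0 int) \<Rightarrow> ('u \<Rightarrow>\<^sub>0 int)"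
  is "\<lambda>a b u. min (a u) (b u)"
proof -
  fix a b :: "'u \<Rightarrow> int"
  assume "finite {u. a u \<noteq> 0}" "finite {u. b u \<noteq> 0}"
  then show "finite {u. min (a u) (b u) \<noteq> 0}"
    by (rule finite_subset[rotated, OF finite_UnI]) (auto simp: min_def)
qed

instantiation trop :: (type) semilattice_inf
begin

definition less_eq_trop :: "'a trop \<Rightarrow> 'a trop \<Rightarrow> bool" where
  "a \<le> b \<longleftrightarrow> (\<forall>u. expo a u \<le> expo b u)"

definition less_trop :: "'a trop \<Rightarrow> 'a trop \<Rightarrow> bool" where
  "(a :: 'a trop) < b \<longleftrightarrow> a \<le> b \<and> \<not> b \<le> a"

definition inf_trop :: "'a trop \<Rightarrow> 'a trop \<Rightarrow> 'a trop" where
  "inf a b = Monomial (min_exponents (exponents a) (exponents b))"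

instance
proof
  fix a b :: "'a trop"
  assume "a \<le> b" "b \<le> a"
  then show "a = b"
    by (intro trop_eqI) (simp add: less_eq_trop_def order_antisym)
qed (auto simp: less_eq_trop_def less_trop_def inf_trop_def expo_def min_exponents.rep_eq
          intro: order_trans)

end

abbreviation trop_add :: "'u trop \<Rightarrow> 'u trop \<Rightarrow> 'u trop" (infixl \<open>\<oplus>\<close> 65) where
  "a \<oplus> b \<equiv> inf a b"

definition trop_sum :: "('b \<Rightarrow> 'u trop) \<Rightarrow> 'b set \<Rightarrow> 'u trop" where
  "trop_sum f A = Inf_fin (f ` A)"

definition var :: "'u \<Rightarrow> 'u trop" where
  "var u = Monomial (Poly_Mapping.single u 1)"

definition tropical_semifield :: "'u set \<Rightarrow> 'u trop set" where
  "tropical_semifield U = {m. \<forall>u. u \<notin> U \<longrightarrow> expo m u = 0}"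

lemma expo_simps [simp]:
  "expo 1 u = 0"
  "expo (a * b) u = expo a u + expo b u"
  "expo (inverse a) u = - expo a u"
  "expo (a \<oplus> b) u = min (expo a u) (expo b u)"
  "expo (var v) u = (if u = v then 1 else 0)"
  by (simp_all add: expo_def one_trop_def times_trop_def inverse_trop_def inf_trop_def
      var_def min_exponents.rep_eq lookup_add lookup_single when_def)

lemma expo_prod: "expo (\<Prod>x\<in>A. f x) u = (\<Sum>x\<in>A. expo (f x) u)"
  by (induction A rule: infinite_finite_induct) simp_all

lemma trop_left_inverse: "inverse a * a = (1 :: 'u trop)"
  by (rule trop_eqI) simp

lemma trop_distrib: "a * (b \<oplus> c) = a * b \<oplus> a * (c :: 'u trop)"
  by (rule trop_eqI) simp

text \<open>
  The evaluation of a Laurent monomial at the semifield; this is not \<open>m\<close> itself.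
\<close>

definition monomial_at_P :: "'u trop \<Rightarrow> 'u trop" where
  "monomial_at_P m = 1 \<oplus> m"


section \<open>Height functions and quivers\<close>

text \<open>
  A height function on \<open>{1..n}\<close> is given together with its extension to \<open>0\<close> and \<open>n + 1\<close>; all other
  values are irrelevant.  For \<open>n \<ge> 2\<close> the extension is determined by the values on \<open>{1..n}\<close>.
  For \<open>n = 1\<close> its two defining equations only say \<open>\<xi> 0 = \<xi> 2\<close>, and every such value is allowed.
\<close>

definition height_function :: "nat \<Rightarrow> (nat \<Rightarrow> int) \<Rightarrow> bool" where
  "height_function n \<xi> \<longleftrightarrow>
     (\<forall>i. 1 \<le> i \<and> i + 1 \<le> n \<longrightarrow> \<bar>\<xi> i - \<xi> (i + 1)\<bar> = 1) \<and>
     \<xi> 0 = \<xi> 2 \<and> \<xi> (n + 1) = \<xi> (n - 1)"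

text \<open>
  For \<open>i < n\<close> the minimum below exists and is at most \<open>n - 1\<close>, because \<open>\<xi> (n - 1) = \<xi> (n + 1)\<close>; in
  particular the value \<open>\<xi> (n + 2)\<close> plays no role.
\<close>

definition diamond :: "nat \<Rightarrow> (nat \<Rightarrow> int) \<Rightarrow> nat \<Rightarrow> nat" where
  "diamond n \<xi> i = (if i = n then n else (LEAST l. l \<in> {i..n} \<and> \<xi> l = \<xi> (l + 2)))"

definition source_or_sink :: "nat \<Rightarrow> (nat \<Rightarrow> int) \<Rightarrow> nat \<Rightarrow> bool" where
  "source_or_sink n \<xi> i \<longleftrightarrow> i = n \<or> \<xi> i = \<xi> (i + 2)"

text \<open>\<open>Mut i\<close> is the mutable vertex \<open>i\<close> and \<open>Fro i\<close> is the frozen vertex \<open>i'\<close>.\<close>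

datatype vertex = Mut nat | Fro nat

definition quiver_vertices :: "nat \<Rightarrow> vertex set" where
  "quiver_vertices n = Mut ` {1..n} \<union> Fro ` {1..n}"

definition local_arrows :: "nat \<Rightarrow> (nat \<Rightarrow> int) \<Rightarrow> nat \<Rightarrow> (vertex \<times> vertex) set" where
  "local_arrows n \<xi> i =
     {(Mut i, Mut (i - 1)), (Fro i, Mut i)} \<union>
     (if i = diamond n \<xi> i then {(Mut i, Mut (i + 1))}
      else {(Mut (i + 1), Mut i), (Mut i, Fro (i + 1))})"

text \<open>
  The arrows of \<open>Q_\<xi>\<close>.  The intersection drops the arrows that involve \<open>0\<close> or \<open>n + 1\<close>.
\<close>

definition quiver :: "nat \<Rightarrow> (nat \<Rightarrow> int) \<Rightarrow> (vertex \<times> vertex) set" where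
  "quiver n \<xi> =
     ((\<Union>i \<in> {i \<in> {1..n}. \<xi> i = \<xi> (i + 1) + 1}. local_arrows n \<xi> i) \<union>
      (\<Union>i \<in> {i \<in> {1..n}. \<xi> i = \<xi> (i + 1) - 1}. (local_arrows n \<xi> i)\<inverse>)) \<inter>
     (quiver_vertices n \<times> quiver_vertices n)"

definition full_subquiver :: "nat \<Rightarrow> (nat \<Rightarrow> int) \<Rightarrow> nat \<Rightarrow> nat \<Rightarrow> (vertex \<times> vertex) set" where
  "full_subquiver n \<xi> i j = quiver n \<xi> \<inter> (Mut ` {i..j} \<times> Mut ` {i..j})"


section \<open>Coefficients\<close>

definition generators :: "nat \<Rightarrow> nat \<Rightarrow> nat \<Rightarrow> vertex set" where
  "generators n i j = Fro ` {1..n} \<union> Mut ` ({1..n} - {i..j})"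

definition y_coeff :: "nat \<Rightarrow> (nat \<Rightarrow> int) \<Rightarrow> nat \<Rightarrow> nat \<Rightarrow> nat \<Rightarrow> vertex trop" where
  "y_coeff n \<xi> i j l =
     (\<Prod>u \<in> {u \<in> generators n i j. (u, Mut l) \<in> quiver n \<xi>}. var u) *
     (\<Prod>u \<in> {u \<in> generators n i j. (Mut l, u) \<in> quiver n \<xi>}. inverse (var u))"

lemma y_coeff_in_tropical_semifield:
  "y_coeff n \<xi> i j l \<in> tropical_semifield (generators n i j)"
proof -
  have "expo (\<Prod>x | x \<in> generators n i j \<and> A x. f x) u = 0"
    if "u \<notin> generators n i j" and "f = var \<or> f = (\<lambda>x. inverse (var x))"
    for u A and f :: "vertex \<Rightarrow> vertex trop"
    unfolding expo_prod using that by (intro sum.neutral) auto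
  then show ?thesis
    by (simp add: tropical_semifield_def y_coeff_def)
qed


section \<open>Snake graphs\<close>

text \<open>
  Snake graphs are realised in the integer lattice: an edge is the set of its two end points, and
  the tile at \<open>(a, b)\<close> is the unit square with south-west corner \<open>(a, b)\<close>.  A snake moves only
  north and east, so tiles share exactly the edges along which they are glued.
\<close>

type_synonym point = "nat \<times> nat"
type_synonym edge = "point set"

fun south_edge :: "point \<Rightarrow> edge" where "south_edge (a, b) = {(a, b), (a + 1, b)}"
fun north_edge :: "point \<Rightarrow> edge" where "north_edge (a, b) = {(a, b + 1), (a + 1, b + 1)}"
fun west_edge :: "point \<Rightarrow> edge" where "west_edge (a, b) = {(a, b), (a, b + 1)}"
fun east_edge :: "point \<Rightarrow> edge" where "east_edge (a, b) = {(a + 1, b), (a + 1, b + 1)}"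

definition tile_edges :: "point \<Rightarrow> edge set" where
  "tile_edges p = {south_edge p, north_edge p, west_edge p, east_edge p}"

text \<open>
  \<open>glued_east n \<xi> i k\<close>: the tile \<open>G_(i+k+1)\<close> is glued to the east edge of \<open>G_(i+k)\<close>; otherwise it is
  glued to the north edge.  Three consecutive tiles lie in one row or column iff the last two
  gluings have the same direction.
\<close>

fun glued_east :: "nat \<Rightarrow> (nat \<Rightarrow> int) \<Rightarrow> nat \<Rightarrow> nat \<Rightarrow> bool" where
  "glued_east n \<xi> i 0 = True"
| "glued_east n \<xi> i (Suc k) =
     (if source_or_sink n \<xi> (i + Suc k) then glued_east n \<xi> i k else \<not> glued_east n \<xi> i k)"

text \<open>The south-west corner of the tile \<open>G_(i+k)\<close>.\<close>

fun tile_pos :: "nat \<Rightarrow> (nat \<Rightarrow> int) \<Rightarrow> nat \<Rightarrow> nat \<Rightarrow> point" where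
  "tile_pos n \<xi> i 0 = (0, 0)"
| "tile_pos n \<xi> i (Suc k) =
     (case tile_pos n \<xi> i k of (a, b) \<Rightarrow> if glued_east n \<xi> i k then (a + 1, b) else (a, b + 1))"

definition tile :: "nat \<Rightarrow> (nat \<Rightarrow> int) \<Rightarrow> nat \<Rightarrow> nat \<Rightarrow> edge set" where
  "tile n \<xi> i l = tile_edges (tile_pos n \<xi> i (l - i))"

definition snake_edges :: "nat \<Rightarrow> (nat \<Rightarrow> int) \<Rightarrow> nat \<Rightarrow> nat \<Rightarrow> edge set" where
  "snake_edges n \<xi> i j = (\<Union>l\<in>{i..j}. tile n \<xi> i l)"

definition perfect_matching :: "edge set \<Rightarrow> edge set \<Rightarrow> bool" where
  "perfect_matching E P \<longleftrightarrow> P \<subseteq> E \<and> (\<forall>v \<in> \<Union>E. \<exists>!e. e \<in> P \<and> v \<in> e)"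

definition Match :: "nat \<Rightarrow> (nat \<Rightarrow> int) \<Rightarrow> nat \<Rightarrow> nat \<Rightarrow> edge set set" where
  "Match n \<xi> i j = {P. perfect_matching (snake_edges n \<xi> i j) P}"

text \<open>The boundary of the union of the tiles \<open>G_l\<close>, \<open>l \<in> J\<close>: an edge inside the union lies in two
  of these tiles, an edge on its boundary in exactly one.\<close>

definition boundary :: "nat \<Rightarrow> (nat \<Rightarrow> int) \<Rightarrow> nat \<Rightarrow> nat set \<Rightarrow> edge set" where
  "boundary n \<xi> i J = {e. \<exists>!l. l \<in> J \<and> e \<in> tile n \<xi> i l}"

definition boundary_matchings :: "nat \<Rightarrow> (nat \<Rightarrow> int) \<Rightarrow> nat \<Rightarrow> nat \<Rightarrow> edge set set" where
  "boundary_matchings n \<xi> i j = {P \<in> Match n \<xi> i j. P \<subseteq> boundary n \<xi> i {i..j}}"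

definition P_minus :: "nat \<Rightarrow> (nat \<Rightarrow> int) \<Rightarrow> nat \<Rightarrow> nat \<Rightarrow> edge set" where
  "P_minus n \<xi> i j =
     (THE P. P \<in> boundary_matchings n \<xi> i j \<and>
       (if (Mut (i + 1), Mut i) \<in> full_subquiver n \<xi> i j
        then west_edge (tile_pos n \<xi> i 0) \<in> P
        else south_edge (tile_pos n \<xi> i 0) \<in> P))"

definition P_plus :: "nat \<Rightarrow> (nat \<Rightarrow> int) \<Rightarrow> nat \<Rightarrow> nat \<Rightarrow> edge set" where
  "P_plus n \<xi> i j = (THE P. P \<in> boundary_matchings n \<xi> i j \<and> P \<noteq> P_minus n \<xi> i j)"

text \<open>The set \<open>J\<close> of (indices of) tiles enclosed by the symmetric difference of \<open>P\<close> and \<open>P_-\<close>.\<close>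

definition enclosed :: "nat \<Rightarrow> (nat \<Rightarrow> int) \<Rightarrow> nat \<Rightarrow> nat \<Rightarrow> edge set \<Rightarrow> nat set" where
  "enclosed n \<xi> i j P =
     (THE J. J \<subseteq> {i..j} \<and>
       (P - P_minus n \<xi> i j) \<union> (P_minus n \<xi> i j - P) = boundary n \<xi> i J)"

definition y_matching :: "nat \<Rightarrow> (nat \<Rightarrow> int) \<Rightarrow> nat \<Rightarrow> nat \<Rightarrow> edge set \<Rightarrow> vertex trop" where
  "y_matching n \<xi> i j P = (\<Prod>l \<in> enclosed n \<xi> i j P. y_coeff n \<xi> i j l)"

text \<open>The tropical evaluation of the \<open>F\<close>-polynomial.\<close>

definition F_at_P :: "nat \<Rightarrow> (nat \<Rightarrow> int) \<Rightarrow> nat \<Rightarrow> nat \<Rightarrow> vertex trop" where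
  "F_at_P n \<xi> i j = trop_sum (y_matching n \<xi> i j) (Match n \<xi> i j)"

end

theory Submission
  imports Defs
begin

text \<open>
  A perfect matching of the snake graph with tiles \<open>G_i, \<dots>, G_j\<close> is determined by the set \<open>J\<close> of tiles
  enclosed by its symmetric difference with \<open>P_-\<close>.  The boundary matching \<open>P_-\<close> orients the path
  \<open>i, \<dots>, j\<close>: for each pair of consecutive tiles, membership in \<open>J\<close> of one prescribed tile of the
  pair forces membership of the other (\<open>matching_encloses_ideal\<close>).  The matchings \<open>P_-\<close> and
  \<open>P_+\<close> correspond to \<open>J = {}\<close> and \<open>J = {i..j}\<close>.  Of the tropical sum it therefore remains to see that
  \<open>1 \<oplus> y_i \<cdots> y_j\<close> is below \<open>\<Prod>l\<in>J. y_l\<close> for every \<open>J\<close> that is closed under these implications.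

  This is checked for one generator \<open>u\<close> at a time (\<open>exponent_of_ideal\<close>).  Either \<open>u\<close> occurs in at most
  one of the coefficients \<open>y_i, \<dots>, y_j\<close>, and then its exponent in the product over \<open>J\<close> is either \<open>0\<close> or
  the exponent in the full product.  Or \<open>u = k'\<close> occurs in exactly \<open>y_(k-1)\<close> and \<open>y_k\<close>, with exponents of
  opposite sign; then the full exponent is \<open>0\<close>, and the implication between \<open>k - 1\<close> and \<open>k\<close> is such that
  \<open>J\<close> cannot contain the negative contribution without the positive one.  The latter holds because the
  implications follow the arrows of the quiver: both turn around exactly at the sources and sinks
  (\<open>glue_used_iff\<close>).

  Statements about matchings are proved by induction on the number of tiles: attaching one more
  square to a graph along an edge \<open>e\<close> extends each perfect matching by the edge opposite to \<open>e\<close>, a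
  matching that contains \<open>e\<close> has a second extension, in which \<open>e\<close> and the opposite edge are replaced by
  the other two sides of the square, and there are no further perfect matchings
  (\<open>perfect_matching_attach_square\<close>).
\<close>

section \<open>Attaching a square to a graph\<close>

lemma perfect_matchingD:
  assumes "perfect_matching E P" "e \<in> P" "e' \<in> P" "v \<in> e" "v \<in> e'"
  shows "e = e'"
proof -
  have "v \<in> \<Union>E"
    using assms by (auto simp: perfect_matching_def)
  then have "\<exists>!e. e \<in> P \<and> v \<in> e"
    using assms(1) unfolding perfect_matching_def by metis
  then show ?thesis
    using assms by metis
qed

lemma perfect_matching_covers:
  assumes "perfect_matching E P" "v \<in> \<Union>E"
  shows "\<exists>e \<in> P. v \<in> e"
proof -
  have "\<exists>!e. e \<in> P \<and> v \<in> e"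
    using assms unfolding perfect_matching_def by metis
  then show ?thesis
    by blast
qed

lemma perfect_matchingI:
  assumes "P \<subseteq> E"
    and "\<And>v. v \<in> \<Union>E \<Longrightarrow> \<exists>e \<in> P. v \<in> e"
    and "pairwise disjnt P"
  shows "perfect_matching E P"
  unfolding perfect_matching_def
proof (intro conjI ballI)
  fix v assume "v \<in> \<Union>E"
  then obtain e where "e \<in> P" "v \<in> e"
    using assms(2) by blast
  moreover have "e' = e" if "e' \<in> P" "v \<in> e'" for e'
    using assms(3) that calculation by (meson disjnt_iff pairwiseD)
  ultimately show "\<exists>!e. e \<in> P \<and> v \<in> e"
    by blast
qed (fact assms(1))

lemma perfect_matching_disjnt:
  assumes "perfect_matching E P"
  shows "pairwise disjnt P"
proof (rule pairwiseI)
  fix e e' assume "e \<in> P" "e' \<in> P" "e \<noteq> e'"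
  then show "disjnt e e'"
    using perfect_matchingD[OF assms] by (meson disjnt_iff)
qed

text \<open>
  The square \<open>p, q, y, x\<close> is attached along its edge \<open>{p, q}\<close>.  Whether the new vertex \<open>x\<close> is matched with
  \<open>y\<close> or with \<open>p\<close> decides between the two kinds of extension.
\<close>

lemma perfect_matching_attach_square:
  assumes e: "{p, q} \<in> E" and "p \<noteq> q" "x \<noteq> y" and x: "x \<notin> \<Union>E" and y: "y \<notin> \<Union>E"
  shows "perfect_matching (E \<union> {{p, x}, {x, y}, {y, q}}) P' \<longleftrightarrow>
    (\<exists>P. perfect_matching E P \<and>
      (P' = insert {x, y} P \<or> {p, q} \<in> P \<and> P' = P - {{p, q}} \<union> {{p, x}, {y, q}}))"
    (is "?pm P' \<longleftrightarrow> ?rhs")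
proof
  let ?E' = "E \<union> {{p, x}, {x, y}, {y, q}}"
  have pq: "p \<in> \<Union>E" "q \<in> \<Union>E"
    using e by blast+
  have ne: "p \<noteq> x" "p \<noteq> y" "q \<noteq> x" "q \<noteq> y"
    using pq x y by metis+
  assume pm: "?pm P'"
  then have sub: "P' \<subseteq> ?E'"
    by (simp add: perfect_matching_def)
  have cover: "\<exists>f \<in> P'. v \<in> f" if "v \<in> \<Union>?E'" for v
    using perfect_matching_covers[OF pm that] .
  note unique = perfect_matchingD[OF pm] and disj = perfect_matching_disjnt[OF pm]
  show ?rhs
  proof (cases "{x, y} \<in> P'")
    case True
    have no: "{p, x} \<notin> P'" "{y, q} \<notin> P'"
      using unique[OF True, of "{p, x}" x] unique[OF True, of "{y, q}" y] ne
      by (auto simp: doubleton_eq_iff)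
    have "perfect_matching E (P' - {{x, y}})"
    proof (rule perfect_matchingI)
      show "P' - {{x, y}} \<subseteq> E"
        using sub no by auto
      show "\<exists>f \<in> P' - {{x, y}}. v \<in> f" if "v \<in> \<Union>E" for v
      proof -
        have "v \<noteq> x" "v \<noteq> y"
          using that x y by auto
        then show ?thesis
          using cover[of v] that by blast
      qed
      show "pairwise disjnt (P' - {{x, y}})"
        using disj by (rule pairwise_subset[OF _ Diff_subset])
    qed
    moreover have "P' = insert {x, y} (P' - {{x, y}})"
      using True by auto
    ultimately show ?thesis
      by blast
  next
    case False
    have px: "{p, x} \<in> P'"
    proof -
      obtain f where "f \<in> P'" "x \<in> f"
        using cover[of x] by auto
      then show ?thesis
        using sub x False ne \<open>x \<noteq> y\<close> by (auto simp: subset_iff)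
    qed
    have yq: "{y, q} \<in> P'"
    proof -
      obtain f where "f \<in> P'" "y \<in> f"
        using cover[of y] by auto
      then show ?thesis
        using sub y False ne \<open>x \<noteq> y\<close> by (auto simp: subset_iff)
    qed
    have no_pq: "{p, q} \<notin> P'"
      using unique[OF px, of "{p, q}" p] ne by (auto simp: doubleton_eq_iff)
    let ?P = "insert {p, q} (P' - {{p, x}, {y, q}})"
    have sub': "P' - {{p, x}, {y, q}} \<subseteq> E"
      using sub False by auto
    have off: "p \<notin> f \<and> q \<notin> f" if "f \<in> P' - {{p, x}, {y, q}}" for f
      using unique[OF px, of f p] unique[OF yq, of f q] that by auto
    have "perfect_matching E ?P"
    proof (rule perfect_matchingI)
      show "?P \<subseteq> E"
        using sub' e by auto
      show "\<exists>f \<in> ?P. v \<in> f" if v: "v \<in> \<Union>E" for v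
      proof -
        have "v \<noteq> x" "v \<noteq> y"
          using v x y by auto
        moreover obtain f where "f \<in> P'" "v \<in> f"
          using cover[of v] v by blast
        ultimately consider "v \<in> {p, q}" | "f \<in> ?P"
          by blast
        then show ?thesis
          using \<open>v \<in> f\<close> by (meson insertI1)
      qed
      have "pairwise disjnt (P' - {{p, x}, {y, q}})"
        using disj by (rule pairwise_subset[OF _ Diff_subset])
      moreover have "disjnt {p, q} f" "disjnt f {p, q}" if "f \<in> P' - {{p, x}, {y, q}}" for f
        using off[OF that] by simp_all
      ultimately show "pairwise disjnt ?P"
        unfolding pairwise_insert by simp
    qed
    moreover have "P' = ?P - {{p, q}} \<union> {{p, x}, {y, q}}"
      using no_pq px yq by auto
    ultimately show ?thesis
      by blast
  qed
next
  let ?E' = "E \<union> {{p, x}, {x, y}, {y, q}}"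
  have pq: "p \<in> \<Union>E" "q \<in> \<Union>E"
    using e by blast+
  have ne: "p \<noteq> x" "p \<noteq> y" "q \<noteq> x" "q \<noteq> y"
    using pq x y by metis+
  have vert: "\<Union>?E' = \<Union>E \<union> {x, y}"
    using pq by auto
  assume ?rhs
  then obtain P where pm: "perfect_matching E P"
    and P': "P' = insert {x, y} P \<or> {p, q} \<in> P \<and> P' = P - {{p, q}} \<union> {{p, x}, {y, q}}"
    by blast
  have sub: "P \<subseteq> E"
    using pm by (simp add: perfect_matching_def)
  then have new: "x \<notin> f \<and> y \<notin> f" if "f \<in> P" for f
    using that x y by auto
  have cover: "\<exists>f \<in> P. v \<in> f" if "v \<in> \<Union>E" for v
    using perfect_matching_covers[OF pm that] .
  note unique = perfect_matchingD[OF pm] and disj = perfect_matching_disjnt[OF pm]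
  from P' show "?pm P'"
  proof
    assume P': "P' = insert {x, y} P"
    show ?thesis
    proof (rule perfect_matchingI)
      show "P' \<subseteq> ?E'"
        unfolding P' using sub by blast
      show "\<exists>f \<in> P'. v \<in> f" if "v \<in> \<Union>?E'" for v
        using that cover[of v] unfolding vert P' by auto
      show "pairwise disjnt P'"
        using disj new unfolding P' pairwise_insert by simp
    qed
  next
    assume "{p, q} \<in> P \<and> P' = P - {{p, q}} \<union> {{p, x}, {y, q}}"
    then have pqP: "{p, q} \<in> P" and P': "P' = P - {{p, q}} \<union> {{p, x}, {y, q}}"
      by auto
    have off: "p \<notin> f \<and> q \<notin> f" if "f \<in> P - {{p, q}}" for f
      using unique[OF pqP, of f p] unique[OF pqP, of f q] that by auto
    show ?thesis
    proof (rule perfect_matchingI)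
      show "P' \<subseteq> ?E'"
        unfolding P' using sub by blast
      show "\<exists>f \<in> P'. v \<in> f" if v: "v \<in> \<Union>?E'" for v
      proof (cases "v \<in> {p, q, x, y}")
        case True
        then show ?thesis
          unfolding P' by auto
      next
        case False
        then obtain f where "f \<in> P" "v \<in> f" "f \<noteq> {p, q}"
          using v cover[of v] unfolding vert by blast
        then show ?thesis
          unfolding P' by blast
      qed
      have P'': "P' = insert {p, x} (insert {y, q} (P - {{p, q}}))"
        unfolding P' by auto
      have "pairwise disjnt (P - {{p, q}})"
        using disj by (rule pairwise_subset[OF _ Diff_subset])
      then show "pairwise disjnt P'"
        using off new ne \<open>p \<noteq> q\<close> \<open>x \<noteq> y\<close> unfolding P'' pairwise_insert by auto
    qed
  qed
qed

lemma perfect_matching_square: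
  assumes "distinct [p, q, x, y]"
  shows "perfect_matching {{p, q}, {p, x}, {x, y}, {y, q}} P \<longleftrightarrow>
    P = {{p, q}, {x, y}} \<or> P = {{p, x}, {y, q}}"
proof -
  have "perfect_matching {{p, q}} Q \<longleftrightarrow> Q = {{p, q}}" for Q
    by (auto simp: perfect_matching_def subset_singleton_iff)
  moreover have "perfect_matching ({{p, q}} \<union> {{p, x}, {x, y}, {y, q}}) P \<longleftrightarrow>
      (\<exists>Q. perfect_matching {{p, q}} Q \<and>
        (P = insert {x, y} Q \<or> {p, q} \<in> Q \<and> P = Q - {{p, q}} \<union> {{p, x}, {y, q}}))"
    using assms by (intro perfect_matching_attach_square) auto
  ultimately have "perfect_matching ({{p, q}} \<union> {{p, x}, {x, y}, {y, q}}) P \<longleftrightarrow>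
      P = {{x, y}, {p, q}} \<or> P = {{p, x}, {y, q}}"
    by simp
  then show ?thesis
    by (simp add: insert_commute)
qed


section \<open>Geometry of the snake\<close>

text \<open>
  Tiles are counted from \<open>0\<close> here: the argument \<open>k\<close> stands for the tile \<open>G_(i+k)\<close>, and the graph
  \<open>edges_upto k\<close> consists of the \<open>k + 1\<close> tiles \<open>G_i, \<dots>, G_(i+k)\<close>.
\<close>

context
  fixes n i :: nat and \<xi> :: "nat \<Rightarrow> int"
begin

abbreviation pos :: "nat \<Rightarrow> point" where
  "pos \<equiv> tile_pos n \<xi> i"

abbreviation east :: "nat \<Rightarrow> bool" where
  "east \<equiv> glued_east n \<xi> i"

text \<open>
  The edge shared by \<open>G_(i+k)\<close> and \<open>G_(i+k+1)\<close>.
\<close>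

definition glue :: "nat \<Rightarrow> edge" where
  "glue k = (if east k then east_edge (pos k) else north_edge (pos k))"

text \<open>
  The edge of the attached tile \<open>G_(i+k+1)\<close> opposite to \<open>glue k\<close>; both of its end points are new.
\<close>

definition cap :: "nat \<Rightarrow> edge" where
  "cap k = (if east k then east_edge (pos (Suc k)) else north_edge (pos (Suc k)))"

text \<open>
  The two edges of the attached tile \<open>G_(i+k+1)\<close> that join \<open>glue k\<close> to \<open>cap k\<close>.
\<close>

definition sides :: "nat \<Rightarrow> edge set" where
  "sides k = (if east k then {south_edge (pos (Suc k)), north_edge (pos (Suc k))}
     else {west_edge (pos (Suc k)), east_edge (pos (Suc k))})"

abbreviation edges_upto :: "nat \<Rightarrow> edge set" where
  "edges_upto k \<equiv> snake_edges n \<xi> i (i + k)"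

lemma tile_conv: "tile n \<xi> i (i + k) = tile_edges (pos k)"
  by (simp add: tile_def)

lemma glue_eq:
  "glue k = (if east k then west_edge (pos (Suc k)) else south_edge (pos (Suc k)))"
  by (cases "pos k") (simp add: glue_def)

lemma tile_Suc: "tile n \<xi> i (i + Suc k) = insert (glue k) (insert (cap k) (sides k))"
  unfolding tile_conv tile_edges_def glue_eq cap_def sides_def
  by (cases "east k") (simp_all only: if_True if_False insert_commute)

lemma edges_upto_0: "edges_upto 0 = tile_edges (pos 0)"
  by (simp add: snake_edges_def tile_def)

lemma glue_in_tile: "glue k \<in> tile n \<xi> i (i + k)"
  unfolding tile_conv glue_def tile_edges_def by auto

lemma edges_upto_Suc: "edges_upto (Suc k) = edges_upto k \<union> tile n \<xi> i (i + Suc k)"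
proof -
  have "{i..i + Suc k} = insert (i + Suc k) {i..i + k}"
    by auto
  then show ?thesis
    unfolding snake_edges_def by (simp only: UN_insert Un_commute)
qed

lemma glue_in_edges_upto: "glue k \<in> edges_upto k"
  using glue_in_tile by (force simp: snake_edges_def)

lemma pos_mono: "k \<le> m \<Longrightarrow> fst (pos k) \<le> fst (pos m) \<and> snd (pos k) \<le> snd (pos m)"
proof (induction m rule: dec_induct)
  case (step m)
  then show ?case
    by (cases "pos m") auto
qed simp

lemma pos_sum: "fst (pos k) + snd (pos k) = k"
proof (induction k)
  case (Suc k)
  then show ?case
    by (cases "pos k") auto
qed simp

lemma tile_vertex_bound:
  "e \<in> tile_edges p \<Longrightarrow> v \<in> e \<Longrightarrow> fst v \<le> fst p + 1 \<and> snd v \<le> snd p + 1"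
  by (cases p) (auto simp: tile_edges_def)

lemma vertex_upto_bound:
  assumes "v \<in> \<Union>(edges_upto k)"
  shows "fst v \<le> fst (pos k) + 1 \<and> snd v \<le> snd (pos k) + 1"
proof -
  from assms obtain l e where l: "i \<le> l" "l \<le> i + k" and e: "e \<in> tile_edges (pos (l - i))" "v \<in> e"
    by (auto simp: snake_edges_def tile_def)
  have "fst (pos (l - i)) \<le> fst (pos k) \<and> snd (pos (l - i)) \<le> snd (pos k)"
    using l by (intro pos_mono) simp
  with tile_vertex_bound[OF e] show ?thesis
    by auto
qed

lemma attach_tile:
  obtains p q x y where "glue k = {p, q}" "cap k = {x, y}" "sides k = {{p, x}, {y, q}}"
    "p \<noteq> q" "x \<noteq> y" "x \<notin> \<Union>(edges_upto k)" "y \<notin> \<Union>(edges_upto k)"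
proof -
  obtain a b where ab: "pos k = (a, b)"
    by (cases "pos k")
  have new: "v \<notin> \<Union>(edges_upto k)" if "fst v > a + 1 \<or> snd v > b + 1" for v
    using vertex_upto_bound[of v k] that unfolding ab by force
  show ?thesis
  proof (cases "east k")
    case True
    then show ?thesis
      using ab that[of "(a + 1, b)" "(a + 1, b + 1)" "(a + 2, b)" "(a + 2, b + 1)"]
      by (auto simp: glue_def cap_def sides_def new insert_commute simp del: Union_iff)
  next
    case False
    then show ?thesis
      using ab that[of "(a, b + 1)" "(a + 1, b + 1)" "(a, b + 2)" "(a + 1, b + 2)"]
      by (auto simp: glue_def cap_def sides_def new insert_commute simp del: Union_iff)
  qed
qed

lemma new_edges:
  "cap k \<notin> edges_upto k" "sides k \<inter> edges_upto k = {}" "cap k \<notin> sides k"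
proof -
  obtain p q x y where *: "glue k = {p, q}" "cap k = {x, y}" "sides k = {{p, x}, {y, q}}"
    "p \<noteq> q" "x \<noteq> y" "x \<notin> \<Union>(edges_upto k)" "y \<notin> \<Union>(edges_upto k)"
    by (rule attach_tile)
  have "p \<in> \<Union>(edges_upto k)" "q \<in> \<Union>(edges_upto k)"
    using glue_in_edges_upto[of k] *(1) by auto
  then have "p \<noteq> x" "p \<noteq> y" "q \<noteq> x" "q \<noteq> y"
    using * by auto
  then show "cap k \<notin> edges_upto k" "sides k \<inter> edges_upto k = {}" "cap k \<notin> sides k"
    using * by (auto simp: doubleton_eq_iff)
qed

lemma perfect_matching_Suc:
  "perfect_matching (edges_upto (Suc k)) P' \<longleftrightarrow>
    (\<exists>P. perfect_matching (edges_upto k) P \<and>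
      (P' = insert (cap k) P \<or> glue k \<in> P \<and> P' = P - {glue k} \<union> sides k))"
proof -
  obtain p q x y where *: "glue k = {p, q}" "cap k = {x, y}" "sides k = {{p, x}, {y, q}}"
    "p \<noteq> q" "x \<noteq> y" "x \<notin> \<Union>(edges_upto k)" "y \<notin> \<Union>(edges_upto k)"
    by (rule attach_tile)
  have "edges_upto (Suc k) = edges_upto k \<union> {{p, x}, {x, y}, {y, q}}"
    unfolding edges_upto_Suc tile_Suc using glue_in_edges_upto[of k] * by auto
  then show ?thesis
    using perfect_matching_attach_square[of p q "edges_upto k" x y P'] glue_in_edges_upto[of k] *
    by simp
qed

lemma tile_Suc_Int_upto: "tile n \<xi> i (i + Suc k) \<inter> edges_upto k = {glue k}"
  using new_edges[of k] glue_in_edges_upto[of k] unfolding tile_Suc by auto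

lemma glue_in_earlier_tile:
  assumes "l \<le> k" "glue k \<in> tile n \<xi> i (i + l)"
  shows "l = k"
proof (rule ccontr)
  assume "l \<noteq> k"
  then obtain m where k: "k = Suc m" "l \<le> m"
    using assms(1) by (cases k) auto
  obtain a b where ab: "pos k = (a, b)"
    by (cases "pos k")
  have "(a + 1, b + 1) \<in> glue k"
    using ab by (auto simp: glue_def)
  with assms(2) have "a + 1 \<le> fst (pos l) + 1 \<and> b + 1 \<le> snd (pos l) + 1"
    using tile_vertex_bound[of "glue k" "pos l" "(a + 1, b + 1)"] by (simp add: tile_conv)
  moreover have "a + b = k" "fst (pos l) + snd (pos l) = l"
    using pos_sum[of k] pos_sum[of l] ab by auto
  ultimately show False
    using k by linarith
qed


lemma glue_in_tile_iff: "glue k \<in> tile n \<xi> i (i + l) \<longleftrightarrow> l = k \<or> l = Suc k"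
proof
  assume g: "glue k \<in> tile n \<xi> i (i + l)"
  show "l = k \<or> l = Suc k"
  proof (cases "l \<le> k")
    case True
    then show ?thesis
      using glue_in_earlier_tile[OF True g] by simp
  next
    case False
    then obtain l' where l': "l = Suc l'" "k \<le> l'"
      by (cases l) auto
    have "glue k \<in> edges_upto l'"
      using glue_in_tile[of k] l'(2) by (force simp: snake_edges_def)
    then have "glue k = glue l'"
      using tile_Suc_Int_upto[of l'] g l'(1) by auto
    then have "k = l'"
      using glue_in_earlier_tile[of k l'] glue_in_tile[of k] l'(2) by simp
    then show ?thesis
      using l'(1) by simp
  qed
next
  assume "l = k \<or> l = Suc k"
  then show "glue k \<in> tile n \<xi> i (i + l)"
    using glue_in_tile[of k] tile_Suc[of k] by auto
qed

lemma south_west_not_in_later_tile: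
  assumes "e = south_edge (pos k) \<or> e = west_edge (pos k)" "k < l"
  shows "e \<notin> tile n \<xi> i (i + l)"
proof
  assume e: "e \<in> tile n \<xi> i (i + l)"
  have "pos k \<in> e"
    using assms(1) by (cases "pos k") auto
  with e have "fst (pos l) + snd (pos l) \<le> fst (pos k) + snd (pos k)"
    unfolding tile_conv by (cases "pos l"; cases "pos k") (auto simp: tile_edges_def)
  then show False
    using assms(2) by (simp add: pos_sum)
qed

text \<open>
  An edge of \<open>G_(i+k)\<close> that lies in no other tile: of its south and west edges, which no later tile
  shares, one along which it is not glued to the preceding tile.
\<close>

definition private_edge :: "nat \<Rightarrow> edge" where
  "private_edge k = (if k = 0 \<or> east (k - 1) then south_edge (pos k) else west_edge (pos k))"

lemma private_edge_in_tile_iff: "private_edge k \<in> tile n \<xi> i (i + l) \<longleftrightarrow> l = k"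
proof
  assume e: "private_edge k \<in> tile n \<xi> i (i + l)"
  have "\<not> k < l"
    using e south_west_not_in_later_tile[of "private_edge k" k l]
    unfolding private_edge_def by (metis (full_types))
  moreover have "\<not> l < k"
  proof
    assume "l < k"
    then obtain k' where k': "k = Suc k'" "l \<le> k'"
      by (cases k) auto
    have "private_edge k \<in> sides k'"
      using k' by (auto simp: private_edge_def sides_def)
    moreover have "private_edge k \<in> edges_upto k'"
      using e k'(2) by (force simp: snake_edges_def)
    ultimately show False
      using new_edges(2)[of k'] by blast
  qed
  ultimately show "l = k"
    by simp
next
  show "private_edge k \<in> tile n \<xi> i (i + l)" if "l = k"
    using that by (auto simp: private_edge_def tile_conv tile_edges_def)
qed

lemma boundary_determines_tiles:
  assumes "J \<subseteq> {i..}" "J' \<subseteq> {i..}" and eq: "boundary n \<xi> i J = boundary n \<xi> i J'"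
  shows "J = J'"
proof -
  have mem: "i + k \<in> K \<longleftrightarrow> private_edge k \<in> boundary n \<xi> i K" if "K \<subseteq> {i..}" for k K
  proof -
    have "private_edge k \<in> tile n \<xi> i l \<longleftrightarrow> l = i + k" if "l \<in> K" for l
      using private_edge_in_tile_iff[of k "l - i"] that \<open>K \<subseteq> {i..}\<close> by auto
    then show ?thesis
      unfolding boundary_def by auto
  qed
  have "l \<in> J \<longleftrightarrow> l \<in> J'" if "i \<le> l" for l
    using mem[OF assms(1), of "l - i"] mem[OF assms(2), of "l - i"] eq that by simp
  then show ?thesis
    using assms(1,2) by auto
qed

lemma glue_in_boundary_iff:
  assumes "J \<subseteq> {i..}"
  shows "glue k \<in> boundary n \<xi> i J \<longleftrightarrow> (i + k \<in> J) \<noteq> (i + Suc k \<in> J)"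
proof -
  have "glue k \<in> tile n \<xi> i l \<longleftrightarrow> l = i + k \<or> l = i + Suc k" if "l \<in> J" for l
    using glue_in_tile_iff[of k "l - i"] that assms by auto
  then have "(\<lambda>l. l \<in> J \<and> glue k \<in> tile n \<xi> i l) = (\<lambda>l. l \<in> J \<and> (l = i + k \<or> l = i + Suc k))"
    by (intro ext) metis
  then have "glue k \<in> boundary n \<xi> i J \<longleftrightarrow> (\<exists>!l. l \<in> J \<and> (l = i + k \<or> l = i + Suc k))"
    unfolding boundary_def mem_Collect_eq by (rule arg_cong)
  also have "\<dots> \<longleftrightarrow> (i + k \<in> J) \<noteq> (i + Suc k \<in> J)"
    by (metis add_left_cancel n_not_Suc_n)
  finally show ?thesis .
qed

text \<open>
  The boundary is additive modulo \<open>2\<close>.  Since it is defined by membership in exactly one tile, this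
  needs that an edge of the new tile lies in at most one of the old tiles.
\<close>

lemma boundary_insert:
  assumes "J \<subseteq> {i..i + k}"
  shows "boundary n \<xi> i (insert (i + Suc k) J) =
    sym_diff (boundary n \<xi> i J) (tile n \<xi> i (i + Suc k))"
proof (rule set_eqI)
  fix e
  let ?T = "tile n \<xi> i (i + Suc k)"
  have new: "i + Suc k \<notin> J"
    using assms by auto
  show "e \<in> boundary n \<xi> i (insert (i + Suc k) J) \<longleftrightarrow> e \<in> sym_diff (boundary n \<xi> i J) ?T"
  proof (cases "e \<in> ?T")
    case False
    then have "l \<in> insert (i + Suc k) J \<and> e \<in> tile n \<xi> i l \<longleftrightarrow> l \<in> J \<and> e \<in> tile n \<xi> i l" for l
      by auto
    then show ?thesis
      using False by (simp add: boundary_def)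
  next
    case True
    have old: "l = i + k" if "l \<in> J" "e \<in> tile n \<xi> i l" for l
    proof -
      have "l \<in> {i..i + k}"
        using that(1) assms by auto
      then have "e \<in> edges_upto k"
        using that(2) by (auto simp: snake_edges_def)
      then have "e = glue k"
        using True tile_Suc_Int_upto[of k] by auto
      then show ?thesis
        using that(2) \<open>l \<in> {i..i + k}\<close> glue_in_earlier_tile[of "l - i" k] by force
    qed
    have "e \<in> boundary n \<xi> i (insert (i + Suc k) J) \<longleftrightarrow> \<not> (\<exists>l\<in>J. e \<in> tile n \<xi> i l)"
      using True new unfolding boundary_def by auto
    moreover have "e \<in> boundary n \<xi> i J \<longleftrightarrow> (\<exists>l\<in>J. e \<in> tile n \<xi> i l)"
      using old unfolding boundary_def by blast
    ultimately show ?thesis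
      using True by blast
  qed
qed

lemma boundary_empty: "boundary n \<xi> i {} = {}"
  unfolding boundary_def by blast

lemma boundary_first: "boundary n \<xi> i {i} = tile n \<xi> i i"
proof -
  have "(\<exists>!l. l \<in> {i} \<and> e \<in> tile n \<xi> i l) \<longleftrightarrow> e \<in> tile n \<xi> i i" for e
    by blast
  then show ?thesis
    unfolding boundary_def by blast
qed


section \<open>Matchings as sets of tiles\<close>

text \<open>
  Of the two perfect matchings by boundary edges of the first \<open>k + 1\<close> tiles, \<open>s\<close> selects the one that
  contains the south edge of \<open>G_i\<close> (\<open>s\<close> true) or its west edge (\<open>s\<close> false).  Its edges in a tile are
  all horizontal or all vertical, alternately along the snake; \<open>glue_used s k\<close> says that \<open>glue k\<close> is one of
  them (see \<open>glue_in_alternating_iff\<close>).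
\<close>

definition glue_used :: "bool \<Rightarrow> nat \<Rightarrow> bool" where
  "glue_used s k \<longleftrightarrow> (east k \<longleftrightarrow> even k \<noteq> s)"

text \<open>
  The boundary matching selected by \<open>s\<close>.  If \<open>glue k\<close>, which becomes an interior edge when the next tile
  is attached, belongs to it, the new tile is flipped; otherwise the opposite edge is added.
\<close>

primrec alternating :: "bool \<Rightarrow> nat \<Rightarrow> edge set" where
  "alternating s 0 = (if s then {south_edge (pos 0), north_edge (pos 0)}
     else {west_edge (pos 0), east_edge (pos 0)})"
| "alternating s (Suc k) = (if glue_used s k then alternating s k - {glue k} \<union> sides k
     else insert (cap k) (alternating s k))"

text \<open>
  The order ideals of the zigzag order on \<open>{i..i+m}\<close> determined by the matching \<open>alternating s m\<close>: a tile
  in which two opposite edges are matched can be flipped first, and of two adjacent tiles the one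
  that contains a matched edge meeting the gluing edge must be flipped before the other.
\<close>

definition order_ideal :: "bool \<Rightarrow> nat \<Rightarrow> nat set \<Rightarrow> bool" where
  "order_ideal s m J \<longleftrightarrow>
     (\<forall>k<m. if glue_used s k then i + k \<in> J \<longrightarrow> i + Suc k \<in> J else i + Suc k \<in> J \<longrightarrow> i + k \<in> J)"

lemma glue_used_not [simp]: "glue_used (\<not> s) k \<longleftrightarrow> \<not> glue_used s k"
  by (auto simp: glue_used_def)

lemma alternating_subset: "alternating s m \<subseteq> edges_upto m"
proof (induction m)
  case 0
  then show ?case
    unfolding edges_upto_0 by (auto simp: tile_edges_def)
next
  case (Suc m)
  then show ?case
    unfolding edges_upto_Suc tile_Suc by auto
qed

text \<open>
  The north and east edges of the last tile are the ones along which the snake can continue.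
\<close>

lemma last_edges_in_alternating:
  "(north_edge (pos m) \<in> alternating s m \<longleftrightarrow> even m = s) \<and>
   (east_edge (pos m) \<in> alternating s m \<longleftrightarrow> even m \<noteq> s)"
proof (cases m)
  case 0
  then show ?thesis
    by (auto simp: doubleton_eq_iff)
next
  case (Suc k)
  have "cap k \<notin> alternating s k" "sides k \<inter> alternating s k = {}"
    using new_edges[of k] alternating_subset[of s k] by auto
  then show ?thesis
    using new_edges(3)[of k] unfolding Suc
    by (cases "east k") (auto simp: glue_used_def cap_def sides_def simp del: tile_pos.simps)
qed

lemma glue_in_alternating_iff: "glue k \<in> alternating s k \<longleftrightarrow> glue_used s k"
  using last_edges_in_alternating[of k s] by (auto simp: glue_def glue_used_def)

lemma alternating_perfect: "perfect_matching (edges_upto m) (alternating s m)"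
proof (induction m)
  case 0
  obtain a b where ab: "pos 0 = (a, b)"
    by (cases "pos 0")
  show ?case
    unfolding edges_upto_0
    using perfect_matching_square[of "(a, b)" "(a + 1, b)" "(a, b + 1)" "(a + 1, b + 1)"
        "alternating s 0"] ab
    by (auto simp: tile_edges_def insert_commute)
next
  case (Suc m)
  then show ?case
    unfolding perfect_matching_Suc using glue_in_alternating_iff[of m s]
    by (intro exI[of _ "alternating s m"]) simp
qed

lemma flip_tile:
  assumes "P \<subseteq> edges_upto k" "glue k \<in> P"
  shows "P - {glue k} \<union> sides k = sym_diff (insert (cap k) P) (tile n \<xi> i (i + Suc k))"
  using assms new_edges[of k] glue_in_edges_upto[of k] unfolding tile_Suc by auto

lemma alternating_Suc:
  "alternating s (Suc k) =
     sym_diff (insert (cap k) (alternating s k)) (if glue_used s k then tile n \<xi> i (i + Suc k) else {})"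
  using flip_tile[OF alternating_subset] glue_in_alternating_iff by simp

lemma sym_diff_alternating:
  "sym_diff (alternating s m) (alternating (\<not> s) m) = boundary n \<xi> i {i..i + m}"
proof (induction m)
  case 0
  then show ?case
    by (cases s) (auto simp: boundary_first tile_def tile_edges_def doubleton_eq_iff)
next
  case (Suc m)
  have new: "cap m \<notin> alternating t m" for t
    using new_edges[of m] alternating_subset[of t m] by auto
  have "sym_diff (alternating s (Suc m)) (alternating (\<not> s) (Suc m)) =
      sym_diff (sym_diff (alternating s m) (alternating (\<not> s) m)) (tile n \<xi> i (i + Suc m))"
    unfolding alternating_Suc using new[of s] new[of "\<not> s"] by (cases "glue_used s m") auto
  also have "\<dots> = boundary n \<xi> i (insert (i + Suc m) {i..i + m})"
    by (subst boundary_insert) (auto simp: Suc)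
  also have "insert (i + Suc m) {i..i + m} = {i..i + Suc m}"
    by auto
  finally show ?case .
qed

lemma alternating_disjoint: "alternating s m \<inter> alternating (\<not> s) m = {}"
proof (induction m)
  case 0
  then show ?case
    by (cases s) (auto simp: doubleton_eq_iff)
next
  case (Suc m)
  have "cap m \<notin> alternating t m \<and> sides m \<inter> alternating t m = {}" for t
    using new_edges[of m] alternating_subset[of t m] by auto
  then show ?case
    using Suc new_edges(3)[of m] by (auto split: if_splits)
qed

lemma alternating_boundary: "alternating s m \<subseteq> boundary n \<xi> i {i..i + m}"
  using sym_diff_alternating[of s m] alternating_disjoint[of s m] by blast

lemma alternating_neq: "alternating (\<not> s) m \<noteq> alternating s m"
proof -
  have "north_edge (pos m) \<in> alternating (\<not> s) m \<longleftrightarrow> north_edge (pos m) \<notin> alternating s m"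
    using last_edges_in_alternating[of m] by auto
  then show ?thesis
    by auto
qed

lemma first_edges_in_alternating:
  "(south_edge (pos 0) \<in> alternating s m \<longleftrightarrow> s) \<and> (west_edge (pos 0) \<in> alternating s m \<longleftrightarrow> \<not> s)"
proof -
  have "e \<in> alternating s m \<longleftrightarrow> e \<in> alternating s 0"
    if "e = south_edge (pos 0) \<or> e = west_edge (pos 0)" for e
  proof (induction m)
    case (Suc m)
    have "e \<notin> tile n \<xi> i (i + Suc m)"
      using south_west_not_in_later_tile[OF that] by blast
    then have "e \<noteq> glue m" "e \<noteq> cap m" "e \<notin> sides m"
      unfolding tile_Suc by blast+
    then show ?case
      using Suc by (simp del: alternating.simps(1))
  qed simp
  from this[of "south_edge (pos 0)"] this[of "west_edge (pos 0)"] show ?thesis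
    by (cases s) (simp_all add: doubleton_eq_iff)
qed

text \<open>
  Attaching a tile changes \<open>J\<close> only by that tile, which belongs to the new \<open>J\<close> iff exactly one of the
  two matchings flips it.  A matching that flips it must contain \<open>glue m\<close>, and whether it does can be
  read off from whether \<open>J\<close> contains the last old tile.
\<close>

lemma matching_encloses_ideal:
  assumes "perfect_matching (edges_upto m) P"
  shows "\<exists>J\<subseteq>{i..i + m}. sym_diff P (alternating s m) = boundary n \<xi> i J \<and> order_ideal s m J"
  using assms
proof (induction m arbitrary: P)
  case 0
  obtain a b where ab: "pos 0 = (a, b)"
    by (cases "pos 0")
  have "P = alternating s 0 \<or> P = alternating (\<not> s) 0"
    using 0 unfolding edges_upto_0
    using perfect_matching_square[of "(a, b)" "(a + 1, b)" "(a, b + 1)" "(a + 1, b + 1)" P] ab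
    by (auto simp: tile_edges_def insert_commute)
  then show ?case
  proof
    assume "P = alternating s 0"
    then show ?thesis
      by (intro exI[of _ "{}"]) (simp del: alternating.simps add: boundary_empty order_ideal_def)
  next
    assume "P = alternating (\<not> s) 0"
    then have "sym_diff P (alternating s 0) = boundary n \<xi> i {i..i + 0}"
      unfolding sym_diff_alternating[of s 0, symmetric] by (simp only: Un_commute)
    then show ?thesis
      by (intro exI[of _ "{i..i + 0}"]) (simp add: order_ideal_def del: alternating.simps)
  qed
next
  case (Suc m)
  let ?l = "i + Suc m" and ?A = "alternating s m"
  from Suc.prems obtain Q where Q: "perfect_matching (edges_upto m) Q"
    and P: "P = insert (cap m) Q \<or> glue m \<in> Q \<and> P = Q - {glue m} \<union> sides m"
    unfolding perfect_matching_Suc by blast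
  from Suc.IH[OF Q] obtain J where J: "J \<subseteq> {i..i + m}"
    "sym_diff Q ?A = boundary n \<xi> i J" "order_ideal s m J"
    by blast
  have Qsub: "Q \<subseteq> edges_upto m"
    using Q by (simp add: perfect_matching_def)
  \<comment> \<open>whether \<open>P\<close> extends \<open>Q\<close> by replacing \<open>glue m\<close> with the sides of the new tile\<close>
  define flipped where "flipped \<longleftrightarrow> P \<noteq> insert (cap m) Q"
  have glueQ: "glue m \<in> Q" if flipped
    using P that unfolding flipped_def by blast
  have P': "P = sym_diff (insert (cap m) Q) (if flipped then tile n \<xi> i ?l else {})"
  proof (cases flipped)
    case True
    then have "P = Q - {glue m} \<union> sides m"
      using P unfolding flipped_def by blast
    also note flip_tile[OF Qsub glueQ[OF True]]
    finally show ?thesis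
      using True by simp
  next
    case False
    then show ?thesis
      unfolding flipped_def by simp
  qed
  define J' where "J' = (if flipped \<longleftrightarrow> glue_used s m then J else insert ?l J)"
  have new: "cap m \<notin> Q" "cap m \<notin> ?A"
    using new_edges[of m] alternating_subset[of s m] Qsub by auto
  have "sym_diff P (alternating s (Suc m)) =
      sym_diff (sym_diff Q ?A) (if flipped \<longleftrightarrow> glue_used s m then {} else tile n \<xi> i ?l)"
    unfolding alternating_Suc P' using new by (cases flipped; cases "glue_used s m") auto
  also have "\<dots> = boundary n \<xi> i J'"
    using boundary_insert[OF J(1)] by (simp add: J'_def J(2))
  finally have eq: "sym_diff P (alternating s (Suc m)) = boundary n \<xi> i J'" .
  have "?l \<notin> J"
    using J(1) by auto
  then have "glue m \<in> sym_diff Q ?A \<longleftrightarrow> i + m \<in> J"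
    using glue_in_boundary_iff[of J m] J(1,2) by force
  then have last: "i + m \<in> J \<longleftrightarrow> (glue m \<in> Q) \<noteq> glue_used s m"
    using glue_in_alternating_iff[of m s] by auto
  have old: "i + k \<in> J' \<longleftrightarrow> i + k \<in> J" if "k \<le> m" for k
    using that by (simp add: J'_def)
  have top: "?l \<in> J' \<longleftrightarrow> flipped \<noteq> glue_used s m"
    using \<open>?l \<notin> J\<close> by (simp add: J'_def)
  have "order_ideal s (Suc m) J'"
    unfolding order_ideal_def
  proof (intro allI impI)
    fix k assume "k < Suc m"
    then consider "k < m" | "k = m"
      by linarith
    then show "if glue_used s k then i + k \<in> J' \<longrightarrow> i + Suc k \<in> J' else i + Suc k \<in> J' \<longrightarrow> i + k \<in> J'"
    proof cases
      case 1
      then have "if glue_used s k then i + k \<in> J \<longrightarrow> i + Suc k \<in> J else i + Suc k \<in> J \<longrightarrow> i + k \<in> J"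
        using J(3) unfolding order_ideal_def by blast
      moreover have "i + k \<in> J' \<longleftrightarrow> i + k \<in> J" "i + Suc k \<in> J' \<longleftrightarrow> i + Suc k \<in> J"
        using 1 old[of k] old[of "Suc k"] by auto
      ultimately show ?thesis
        by (simp only:)
    next
      case 2
      show ?thesis
        unfolding 2 top old[OF order_refl] last using glueQ by auto
    qed
  qed
  moreover have "J' \<subseteq> {i..?l}"
    using J(1) by (auto simp: J'_def)
  ultimately show ?case
    using eq by blast
qed

text \<open>
  If a matching contains no gluing edge, neither does its symmetric difference with a boundary
  matching, so that two adjacent tiles are both enclosed or both not.
\<close>

lemma boundary_matchings_eq:
  "boundary_matchings n \<xi> i (i + m) = {alternating s m, alternating (\<not> s) m}"
proof (intro equalityI subsetI)
  fix P assume "P \<in> boundary_matchings n \<xi> i (i + m)"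
  then have pm: "perfect_matching (edges_upto m) P" and bd: "P \<subseteq> boundary n \<xi> i {i..i + m}"
    by (auto simp: boundary_matchings_def Match_def)
  from matching_encloses_ideal[OF pm] obtain J where J: "J \<subseteq> {i..i + m}"
    "sym_diff P (alternating s m) = boundary n \<xi> i J"
    by blast
  have step: "i + k \<in> J \<longleftrightarrow> i + Suc k \<in> J" if "k < m" for k
  proof -
    have "glue k \<notin> boundary n \<xi> i {i..i + m}"
      using that by (subst glue_in_boundary_iff) auto
    then have "glue k \<notin> boundary n \<xi> i J"
      using J(2) bd alternating_boundary[of s m] by blast
    then show ?thesis
      using glue_in_boundary_iff[of J k] J(1) by force
  qed
  have const: "i + k \<in> J \<longleftrightarrow> i \<in> J" if "k \<le> m" for k
    using that by (induction k) (use step in auto)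
  have "J = {} \<or> J = {i..i + m}"
  proof (cases "i \<in> J")
    case True
    have "l \<in> J" if "l \<in> {i..i + m}" for l
      using const[of "l - i"] that True by force
    then show ?thesis
      using J(1) by auto
  next
    case False
    have "l \<notin> J" if "l \<in> {i..i + m}" for l
      using const[of "l - i"] that False by force
    then show ?thesis
      using J(1) by auto
  qed
  then show "P \<in> {alternating s m, alternating (\<not> s) m}"
  proof
    assume "J = {}"
    then show ?thesis
      using J(2) by (auto simp: boundary_empty)
  next
    assume "J = {i..i + m}"
    then have "sym_diff P (alternating s m) = sym_diff (alternating s m) (alternating (\<not> s) m)"
      using J(2) sym_diff_alternating by simp
    then have "P = alternating (\<not> s) m"
      by blast
    then show ?thesis
      by simp
  qed
next
  fix P assume "P \<in> {alternating s m, alternating (\<not> s) m}"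
  then show "P \<in> boundary_matchings n \<xi> i (i + m)"
    using alternating_perfect alternating_boundary
    unfolding boundary_matchings_def Match_def by blast
qed

text \<open>
  The value of \<open>s\<close> for which \<open>alternating s m\<close> is \<open>P_-\<close>.
\<close>

definition south_start :: "nat \<Rightarrow> bool" where
  "south_start m \<longleftrightarrow> (Mut (i + 1), Mut i) \<notin> full_subquiver n \<xi> i (i + m)"

lemma P_minus_eq: "P_minus n \<xi> i (i + m) = alternating (south_start m) m"
  unfolding P_minus_def
proof (rule the_equality)
  let ?s = "south_start m"
  show "alternating ?s m \<in> boundary_matchings n \<xi> i (i + m) \<and>
    (if (Mut (i + 1), Mut i) \<in> full_subquiver n \<xi> i (i + m)
     then west_edge (pos 0) \<in> alternating ?s m else south_edge (pos 0) \<in> alternating ?s m)"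
    using boundary_matchings_eq[of m ?s] first_edges_in_alternating[of ?s m]
    by (auto simp: south_start_def simp del: tile_pos.simps)
  fix P
  assume P: "P \<in> boundary_matchings n \<xi> i (i + m) \<and>
    (if (Mut (i + 1), Mut i) \<in> full_subquiver n \<xi> i (i + m)
     then west_edge (pos 0) \<in> P else south_edge (pos 0) \<in> P)"
  then have "P = alternating ?s m \<or> P = alternating (\<not> ?s) m"
    using boundary_matchings_eq[of m ?s] by auto
  moreover have "P \<noteq> alternating (\<not> ?s) m"
    using P first_edges_in_alternating[of "\<not> ?s" m]
    by (auto simp: south_start_def simp del: tile_pos.simps split: if_splits)
  ultimately show "P = alternating ?s m"
    by blast
qed

lemma P_plus_eq: "P_plus n \<xi> i (i + m) = alternating (\<not> south_start m) m"
  unfolding P_plus_def P_minus_eq boundary_matchings_eq[of m "south_start m"]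
  using alternating_neq by (intro the_equality) auto

lemma enclosed_eqI:
  assumes "J \<subseteq> {i..i + m}" "sym_diff P (alternating (south_start m) m) = boundary n \<xi> i J"
  shows "enclosed n \<xi> i (i + m) P = J"
  unfolding enclosed_def P_minus_eq
proof (rule the_equality)
  fix K
  assume "K \<subseteq> {i..i + m} \<and> sym_diff P (alternating (south_start m) m) = boundary n \<xi> i K"
  then show "K = J"
    using assms by (intro boundary_determines_tiles) auto
qed (use assms in auto)

lemma enclosed_order_ideal:
  assumes "P \<in> Match n \<xi> i (i + m)"
  shows "enclosed n \<xi> i (i + m) P \<subseteq> {i..i + m}"
    and "order_ideal (south_start m) m (enclosed n \<xi> i (i + m) P)"
proof -
  from assms have "perfect_matching (edges_upto m) P"
    by (simp add: Match_def)
  from matching_encloses_ideal[OF this, of "south_start m"] obtain J where J: "J \<subseteq> {i..i + m}"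
    "sym_diff P (alternating (south_start m) m) = boundary n \<xi> i J" "order_ideal (south_start m) m J"
    by blast
  then show "enclosed n \<xi> i (i + m) P \<subseteq> {i..i + m}"
    and "order_ideal (south_start m) m (enclosed n \<xi> i (i + m) P)"
    using enclosed_eqI[OF J(1,2)] by simp_all
qed

lemma enclosed_P_minus: "enclosed n \<xi> i (i + m) (P_minus n \<xi> i (i + m)) = {}"
  by (rule enclosed_eqI) (simp_all add: P_minus_eq boundary_empty)

lemma enclosed_P_plus: "enclosed n \<xi> i (i + m) (P_plus n \<xi> i (i + m)) = {i..i + m}"
  using sym_diff_alternating[of "south_start m" m]
  by (intro enclosed_eqI) (auto simp: P_plus_eq)

lemma finite_Match: "finite (Match n \<xi> i j)"
proof -
  have "finite (snake_edges n \<xi> i j)"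
    by (simp add: snake_edges_def tile_def tile_edges_def)
  then have "finite (Pow (snake_edges n \<xi> i j))"
    by simp
  then show ?thesis
    by (rule finite_subset[rotated]) (auto simp: Match_def perfect_matching_def)
qed

lemma P_minus_in_Match: "P_minus n \<xi> i (i + m) \<in> Match n \<xi> i (i + m)"
  by (simp add: P_minus_eq Match_def alternating_perfect)

lemma P_plus_in_Match: "P_plus n \<xi> i (i + m) \<in> Match n \<xi> i (i + m)"
  by (simp add: P_plus_eq Match_def alternating_perfect)

end


section \<open>Arrows and exponents\<close>

lemma diamond_eq_iff:
  assumes "height_function n \<xi>" "1 \<le> l" "l \<le> n"
  shows "l = diamond n \<xi> l \<longleftrightarrow> source_or_sink n \<xi> l"
proof (cases "l = n")
  case False
  define Q where "Q = (\<lambda>m. m \<in> {l..n} \<and> \<xi> m = \<xi> (m + 2))"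
  have diamond: "diamond n \<xi> l = Least Q"
    using False by (simp add: diamond_def Q_def)
  \<comment> \<open>the minimum is over a nonempty set: \<open>n - 1\<close> is an element by the extension of \<open>\<xi>\<close> to \<open>n + 1\<close>\<close>
  have "n - 1 + 2 = n + 1"
    using assms False by simp
  then have "Q (n - 1)"
    using assms False unfolding Q_def height_function_def by auto
  then have "Q (Least Q)"
    by (rule LeastI)
  moreover have "Least Q = l" if "Q l"
    using that by (intro Least_equality) (auto simp: Q_def)
  moreover have "source_or_sink n \<xi> l \<longleftrightarrow> Q l"
    using False assms by (auto simp: Q_def source_or_sink_def)
  ultimately show ?thesis
    unfolding diamond by metis
qed (simp add: diamond_def source_or_sink_def)

lemma height_step:
  assumes "height_function n \<xi>" "2 \<le> n" "1 \<le> l" "l \<le> n"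
  shows "\<xi> l = \<xi> (l + 1) + 1 \<or> \<xi> l = \<xi> (l + 1) - 1"
proof -
  have "\<bar>\<xi> l - \<xi> (l + 1)\<bar> = 1"
  proof (cases "l = n")
    case True
    have "1 \<le> n - 1" "n - 1 + 1 = n"
      using assms(2) by auto
    then have "\<bar>\<xi> (n - 1) - \<xi> n\<bar> = 1" "\<xi> (n + 1) = \<xi> (n - 1)"
      using assms(1) unfolding height_function_def by (metis order_refl)+
    then show ?thesis
      using True by (simp add: abs_minus_commute)
  next
    case False
    then show ?thesis
      using assms by (auto simp: height_function_def)
  qed
  then show ?thesis
    by arith
qed

text \<open>
  The sources and sinks \<open>l < n\<close> are the vertices at which the height function changes its direction.
\<close>

lemma source_or_sink_iff:
  assumes "height_function n \<xi>" "1 \<le> l" "l < n"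
  shows "source_or_sink n \<xi> l \<longleftrightarrow> (\<xi> l = \<xi> (l + 1) + 1) \<noteq> (\<xi> (l + 1) = \<xi> (l + 2) + 1)"
  using height_step[OF assms(1), of l] height_step[OF assms(1), of "l + 1"] assms
  by (auto simp: source_or_sink_def)

lemma arrow_from_frozen:
  "(Fro k, Mut l) \<in> quiver n \<xi> \<longleftrightarrow> k \<in> {1..n} \<and> l \<in> {1..n} \<and>
    (k = l \<and> \<xi> l = \<xi> (l + 1) + 1 \<or> k = l + 1 \<and> \<xi> l = \<xi> (l + 1) - 1 \<and> l \<noteq> diamond n \<xi> l)"
  by (auto simp: quiver_def local_arrows_def quiver_vertices_def split: if_splits)

lemma arrow_to_frozen:
  "(Mut l, Fro k) \<in> quiver n \<xi> \<longleftrightarrow> k \<in> {1..n} \<and> l \<in> {1..n} \<and>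
    (k = l \<and> \<xi> l = \<xi> (l + 1) - 1 \<or> k = l + 1 \<and> \<xi> l = \<xi> (l + 1) + 1 \<and> l \<noteq> diamond n \<xi> l)"
  by (auto simp: quiver_def local_arrows_def quiver_vertices_def split: if_splits)

lemma mutable_arrow_adjacent:
  "(Mut a, Mut b) \<in> quiver n \<xi> \<Longrightarrow> a = b + 1 \<or> b = a + 1"
  by (auto simp: quiver_def local_arrows_def quiver_vertices_def split: if_splits)

text \<open>
  The arrow between \<open>l\<close> and \<open>l + 1\<close> is described twice, at \<open>l\<close> and at \<open>l + 1\<close>; the two descriptions agree,
  and the one at \<open>l + 1\<close> needs no case distinction.
\<close>

lemma arrow_down_iff:
  assumes "height_function n \<xi>" "1 \<le> l" "l < n"
  shows "(Mut (l + 1), Mut l) \<in> quiver n \<xi> \<longleftrightarrow> \<xi> (l + 1) = \<xi> (l + 2) + 1"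
proof
  have down: "(Mut (l + 1), Mut l) \<in> local_arrows n \<xi> k \<longleftrightarrow> k = l + 1 \<or> k = l \<and> k \<noteq> diamond n \<xi> k"
    and up: "(Mut l, Mut (l + 1)) \<in> local_arrows n \<xi> k \<longleftrightarrow> k = l \<and> k = diamond n \<xi> k" for k
    by (cases "diamond n \<xi> k = k"; auto simp: local_arrows_def)+
  assume "(Mut (l + 1), Mut l) \<in> quiver n \<xi>"
  then obtain k where
    "\<xi> k = \<xi> (k + 1) + 1 \<and> (Mut (l + 1), Mut l) \<in> local_arrows n \<xi> k \<or>
     \<xi> k = \<xi> (k + 1) - 1 \<and> (Mut l, Mut (l + 1)) \<in> local_arrows n \<xi> k"
    unfolding quiver_def by blast
  then consider "\<xi> (l + 1) = \<xi> (l + 1 + 1) + 1"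
    | "\<xi> l = \<xi> (l + 1) + 1" "l \<noteq> diamond n \<xi> l" | "\<xi> l = \<xi> (l + 1) - 1" "l = diamond n \<xi> l"
    unfolding down up by blast
  then show "\<xi> (l + 1) = \<xi> (l + 2) + 1"
  proof cases
    case 2
    then show ?thesis
      using diamond_eq_iff[OF assms(1), of l] source_or_sink_iff[OF assms] assms(2,3) by simp
  next
    case 3
    then have "source_or_sink n \<xi> l" "\<xi> l \<noteq> \<xi> (l + 1) + 1"
      using diamond_eq_iff[OF assms(1), of l] assms(2,3) by auto
    then show ?thesis
      using source_or_sink_iff[OF assms] by blast
  qed simp
next
  assume "\<xi> (l + 1) = \<xi> (l + 2) + 1"
  then have "l + 1 \<in> {k \<in> {1..n}. \<xi> k = \<xi> (k + 1) + 1}"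
    using assms by simp
  moreover have "(Mut (l + 1), Mut l) \<in> local_arrows n \<xi> (l + 1)"
    by (simp add: local_arrows_def)
  moreover have "Mut (l + 1) \<in> quiver_vertices n" "Mut l \<in> quiver_vertices n"
    using assms by (auto simp: quiver_vertices_def)
  ultimately show "(Mut (l + 1), Mut l) \<in> quiver n \<xi>"
    unfolding quiver_def by blast
qed

text \<open>
  The order on the tiles agrees with the arrows of the quiver: the right-hand side says that the
  arrow between \<open>i + k\<close> and \<open>i + k + 1\<close> points to \<open>i + k\<close>.
\<close>

lemma glue_used_iff:
  assumes "height_function n \<xi>" "1 \<le> i" "i + m \<le> n" "k < m"
  shows "glue_used n i \<xi> (south_start n i \<xi> m) k \<longleftrightarrow> \<xi> (i + Suc k) = \<xi> (i + Suc k + 1) + 1"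
  using assms(4)
proof (induction k)
  case 0
  have "glue_used n i \<xi> (south_start n i \<xi> m) 0 \<longleftrightarrow> (Mut (i + 1), Mut i) \<in> full_subquiver n \<xi> i (i + m)"
    by (simp add: glue_used_def south_start_def)
  also have "\<dots> \<longleftrightarrow> (Mut (i + 1), Mut i) \<in> quiver n \<xi>"
    using 0 by (auto simp: full_subquiver_def)
  also have "\<dots> \<longleftrightarrow> \<xi> (i + 1) = \<xi> (i + 2) + 1"
    using assms 0 by (intro arrow_down_iff) auto
  finally show ?case
    by simp
next
  case (Suc k)
  have "glue_used n i \<xi> s (Suc k) \<longleftrightarrow> glue_used n i \<xi> s k \<noteq> source_or_sink n \<xi> (i + Suc k)" for s
    by (auto simp: glue_used_def)
  then show ?case
    using Suc assms source_or_sink_iff[of n \<xi> "i + Suc k"] by auto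
qed

lemma expo_y_coeff:
  "expo (y_coeff n \<xi> i j l) u =
    of_bool (u \<in> generators n i j \<and> (u, Mut l) \<in> quiver n \<xi>) -
    of_bool (u \<in> generators n i j \<and> (Mut l, u) \<in> quiver n \<xi>)"
proof -
  have fin: "finite {u \<in> generators n i j. R u}" for R
    by (rule finite_subset[of _ "generators n i j"]) (auto simp: generators_def)
  have "(\<Sum>v \<in> {v \<in> generators n i j. R v}. if u = v then c else 0) =
      c * of_bool (u \<in> generators n i j \<and> R u)" for c :: int and R
    using fin[of R] by simp
  from this[of 1 "\<lambda>v. (v, Mut l) \<in> quiver n \<xi>"] this[of "- 1" "\<lambda>v. (Mut l, v) \<in> quiver n \<xi>"]
  moreover have "expo (inverse (var v)) u = (if u = v then - 1 else 0)" for v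
    by simp
  ultimately show ?thesis
    unfolding y_coeff_def expo_simps(2) expo_prod by (simp only: expo_simps(5))
qed

lemma min_sum_le_sum_single_support:
  fixes c :: "'b \<Rightarrow> int"
  assumes "finite A" "J \<subseteq> A" "\<And>l. l \<in> A \<Longrightarrow> c l \<noteq> 0 \<Longrightarrow> l = a"
  shows "min 0 (sum c A) \<le> sum c J"
proof -
  have "sum c B = (if a \<in> B then c a else 0)" if "B \<subseteq> A" for B
  proof -
    have "sum c B = sum c (B \<inter> {a})"
      using that assms finite_subset[OF that assms(1)]
      by (intro sum.mono_neutral_right) auto
    then show ?thesis
      by simp
  qed
  from this[of A] this[OF assms(2)] show ?thesis
    using assms(2) by auto
qed

lemma min_sum_le_sum_cancelling_pair:
  fixes c :: "'b \<Rightarrow> int"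
  assumes "finite A" "J \<subseteq> A" "\<And>l. l \<in> A \<Longrightarrow> l \<noteq> a \<Longrightarrow> l \<noteq> b \<Longrightarrow> c l = 0"
    and "{a, b} \<subseteq> A" "a \<noteq> b" "c a + c b = 0"
    and "if c b > 0 then a \<in> J \<longrightarrow> b \<in> J else b \<in> J \<longrightarrow> a \<in> J"
  shows "min 0 (sum c A) \<le> sum c J"
proof -
  have eq: "sum c B = (if a \<in> B then c a else 0) + (if b \<in> B then c b else 0)" if "B \<subseteq> A" for B
  proof -
    have "sum c B = sum c (B \<inter> {a, b})"
      using that assms finite_subset[OF that assms(1)]
      by (intro sum.mono_neutral_right) auto
    also have "\<dots> = (if a \<in> B then c a else 0) + (if b \<in> B then c b else 0)"
      using assms(5) by auto
    finally show ?thesis .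
  qed
  from eq[of A] eq[OF assms(2)] show ?thesis
    using assms(4,6,7) by (auto split: if_splits)
qed

text \<open>
  The exponent of each generator in the product over an order ideal is at least that in
  \<open>1 \<oplus> y_i \<cdots> y_(i+m)\<close>.
\<close>

lemma exponent_of_ideal:
  assumes hf: "height_function n \<xi>" and i: "1 \<le> i" and j: "i + m \<le> n"
    and J: "J \<subseteq> {i..i + m}" and ideal: "order_ideal n i \<xi> (south_start n i \<xi> m) m J"
  shows "min 0 (\<Sum>l\<in>{i..i + m}. expo (y_coeff n \<xi> i (i + m) l) u)
    \<le> (\<Sum>l\<in>J. expo (y_coeff n \<xi> i (i + m) l) u)"
    (is "min 0 (sum ?c _) \<le> _")
proof (cases "u \<in> generators n i (i + m)")
  case False
  then show ?thesis
    by (simp add: expo_y_coeff)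
next
  case True
  have fin: "finite {i..i + m}"
    by simp
  show ?thesis
  proof (cases u)
    case (Mut k)
    then have k: "k \<notin> {i..i + m}"
      using True by (auto simp: generators_def)
    have "k = l + 1 \<or> l = k + 1" if "?c l \<noteq> 0" for l
    proof -
      have "(Mut k, Mut l) \<in> quiver n \<xi> \<or> (Mut l, Mut k) \<in> quiver n \<xi>"
        using that unfolding expo_y_coeff Mut by fastforce
      then show ?thesis
        using mutable_arrow_adjacent by blast
    qed
    \<comment> \<open>the vertex \<open>k\<close> lies outside the interval, so at most one of its neighbours lies inside\<close>
    then have "l = (if k < i then i else i + m)" if "l \<in> {i..i + m}" "?c l \<noteq> 0" for l
      using that k by force
    then show ?thesis
      by (rule min_sum_le_sum_single_support[OF fin J])
  next
    case (Fro k)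
    have supp: "k = l \<or> k = l + 1" if "?c l \<noteq> 0" for l
    proof -
      have "(Fro k, Mut l) \<in> quiver n \<xi> \<or> (Mut l, Fro k) \<in> quiver n \<xi>"
        using that unfolding expo_y_coeff Fro by fastforce
      then show ?thesis
        unfolding arrow_from_frozen arrow_to_frozen by blast
    qed
    show ?thesis
    proof (cases "i < k \<and> k \<le> i + m \<and> \<not> source_or_sink n \<xi> (k - 1)")
      case False
      then consider "k \<le> i" | "i + m < k" | "i < k" "k \<le> i + m" "source_or_sink n \<xi> (k - 1)"
        by linarith
      then show ?thesis
      proof cases
        case 1
        then show ?thesis
          using supp by (intro min_sum_le_sum_single_support[OF fin J, of _ k]) force
      next
        case 2
        then show ?thesis
          using supp by (intro min_sum_le_sum_single_support[OF fin J, of _ "k - 1"]) force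
      next
        case 3
        \<comment> \<open>there is no arrow between \<open>k'\<close> and a source or sink \<open>k - 1\<close>\<close>
        then have "?c (k - 1) = 0"
          using diamond_eq_iff[OF hf, of "k - 1"] i j
          by (auto simp: expo_y_coeff Fro arrow_from_frozen arrow_to_frozen)
        then show ?thesis
          using supp 3 by (intro min_sum_le_sum_single_support[OF fin J, of _ k]) force
      qed
    next
      \<comment> \<open>the height function keeps its direction at \<open>k - 1\<close>, so \<open>k'\<close> is joined to both \<open>k\<close> and \<open>k - 1\<close>,
        by one ingoing and one outgoing arrow\<close>
      case inner: True
      then obtain t where t: "k = i + Suc t" "t < m"
        using less_imp_Suc_add[of i k] by auto
      let ?a = "i + t" and ?b = "i + Suc t"
      have same_direction: "(\<xi> ?a = \<xi> ?b + 1) = (\<xi> ?b = \<xi> (?b + 1) + 1)"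
        and not_diamond: "?a \<noteq> diamond n \<xi> ?a"
        using inner t i j source_or_sink_iff[OF hf, of ?a] diamond_eq_iff[OF hf, of ?a] by auto
      have steps: "\<xi> ?a = \<xi> ?b + 1 \<or> \<xi> ?a = \<xi> ?b - 1" "\<xi> ?b = \<xi> (?b + 1) + 1 \<or> \<xi> ?b = \<xi> (?b + 1) - 1"
        using height_step[OF hf, of ?a] height_step[OF hf, of ?b] i j t by auto
      have b: "?c ?b = (if \<xi> ?b = \<xi> (?b + 1) + 1 then 1 else - 1)"
        using True steps(2) i j t
        by (auto simp: expo_y_coeff Fro arrow_from_frozen arrow_to_frozen)
      have a: "?c ?a = (if \<xi> ?a = \<xi> ?b + 1 then - 1 else 1)"
        using True steps(1) i j t not_diamond
        by (auto simp: expo_y_coeff Fro arrow_from_frozen arrow_to_frozen)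
      show ?thesis
      proof (rule min_sum_le_sum_cancelling_pair[OF fin J])
        show "?c l = 0" if "l \<noteq> ?a" "l \<noteq> ?b" for l
          using supp[of l] that t by auto
        show "{?a, ?b} \<subseteq> {i..i + m}" "?a \<noteq> ?b"
          using t by auto
        show "?c ?a + ?c ?b = 0"
          unfolding a b using same_direction by simp
        show "if ?c ?b > 0 then ?a \<in> J \<longrightarrow> ?b \<in> J else ?b \<in> J \<longrightarrow> ?a \<in> J"
          unfolding b using ideal t(2) glue_used_iff[OF hf i j t(2)]
          by (auto simp: order_ideal_def split: if_splits)
      qed
    qed
  qed
qed

theorem lemma3p7:
  fixes n i j :: nat and \<xi> :: "nat \<Rightarrow> int"
  assumes "height_function n \<xi>"
    and "1 \<le> i" and "i \<le> j" and "j \<le> n"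
  shows "F_at_P n \<xi> i j = monomial_at_P (y_matching n \<xi> i j (P_plus n \<xi> i j)) \<and>
    monomial_at_P (y_matching n \<xi> i j (P_plus n \<xi> i j)) =
      monomial_at_P (\<Prod>l\<in>{i..j}. y_coeff n \<xi> i j l)"
proof -
  obtain m where j: "j = i + m"
    using assms(3) le_Suc_ex by blast
  let ?Y = "y_matching n \<xi> i j" and ?M = "Match n \<xi> i j"
  let ?all = "\<Prod>l\<in>{i..j}. y_coeff n \<xi> i j l"
  have plus: "?Y (P_plus n \<xi> i j) = ?all"
    by (simp add: y_matching_def j enclosed_P_plus)
  have minus: "?Y (P_minus n \<xi> i j) = 1"
    by (simp add: y_matching_def j enclosed_P_minus)
  have "1 \<oplus> ?all \<le> ?Y P" if "P \<in> ?M" for P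
    unfolding less_eq_trop_def y_matching_def
    using exponent_of_ideal[OF assms(1,2) assms(4)[unfolded j] enclosed_order_ideal[OF that[unfolded j]]]
    by (simp add: expo_prod j)
  then have "1 \<oplus> ?all \<le> Inf_fin (?Y ` ?M)"
    using P_minus_in_Match[of n \<xi> i m] finite_Match[of n \<xi> i j]
    by (intro Inf_fin.boundedI) (auto simp: j)
  moreover have "Inf_fin (?Y ` ?M) \<le> ?Y P" if "P \<in> ?M" for P
    using finite_Match that by (intro Inf_fin.coboundedI) auto
  from this[of "P_plus n \<xi> i j"] this[of "P_minus n \<xi> i j"]
  have "Inf_fin (?Y ` ?M) \<le> 1 \<oplus> ?all"
    using P_minus_in_Match P_plus_in_Match unfolding plus minus by (simp add: j)
  ultimately have "F_at_P n \<xi> i j = 1 \<oplus> ?all"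
    unfolding F_at_P_def trop_sum_def by (rule order_antisym[rotated])
  then show ?thesis
    unfolding plus by (simp add: monomial_at_P_def)
qed

end
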